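(* If $G$ is a connected graph of order $n \ge 3$, then $c_{\min}(G) = n$ if and only if $G \in \mathcal{M}$.
   Context: Graphs are finite, simple and undirected, with nonempty vertex set; the order of $G$ is $|V(G)|$. A set $S\subseteq V(G)$ is a dominating set of $G$ if every vertex of $V(G)\setminus S$ is adjacent to a vertex of $S$. All parts of a partition are nonempty. Two disjoint sets $X,Y\subseteq V(G)$ form a coalition in $G$ if neither $X$ nor $Y$ is a dominating set of $G$ but $X\cup Y$ is a dominating set of $G$. A $c$-partition of $G$ is a partition $\{V_1,\ldots,V_k\}$ of $V(G)$ such that each $V_i$ either is a dominating set consisting of a single vertex, or forms a coalition with some other set $V_j$ ($j\neq i$) of the partition. For partitions $\mathcal{A},\mathcal{B}$ of $V(G)$, $\mathcal{B}$ is a refinement of $\mathcal{A}$ if every set of $\mathcal{B}$ is equal to or a proper subset of some set of $\mathcal{A}$; it is a proper refinement if moreover $\mathcal{A}\ne\mathcal{B}$. A $c$-partition is minimal if it is not a proper refinement of any other $c$-partition of $G$. The minmin coalition number $c_{\min}(G)$ is the minimum number of sets in a minimal $c$-partition of $G$. The join $F+H$ of two graphs $F$ and $H$ is the graph formed from disjoint copies of $F$ and $H$ by joining every vertex of $F$ to every vertex of $H$. $K_m$ is the complete graph on $m$ vertices, and $\overline{K}_2$ is the graph with two vertices and no edges. The family $\mathcal{M}$ of graphs (up to isomorphism) is generated recursively: $K_1$, $K_2$ and $\overline{K}_2$ belong to $\mathcal{M}$; and whenever $H\in\mathcal{M}$, the graphs $K_1+H$ and $\overline{K}_2+H$ belong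 to $\mathcal{M}$ (and nothing else belongs to $\mathcal{M}$). *)

theory Defs
  imports "Graph_Theory.Graph_Theory" "HOL-Library.Disjoint_Sets"
begin

text \<open>
  A finite simple undirected graph is a \<open>pair_graph\<close>: the edge \<open>uv\<close> is the pair of arcs
  \<open>(u,v)\<close>, \<open>(v,u)\<close>. That locale admits the null graph, whereas \<open>connected\<close> excludes it.
\<close>

definition dominating_set :: "'a pair_pre_digraph \<Rightarrow> 'a set \<Rightarrow> bool" where
  "dominating_set G S \<longleftrightarrow>
     S \<subseteq> pverts G \<and> (\<forall>v \<in> pverts G - S. \<exists>u \<in> S. (v, u) \<in> parcs G)"

definition coalition :: "'a pair_pre_digraph \<Rightarrow> 'a set \<Rightarrow> 'a set \<Rightarrow> bool" where
  "coalition G X Y \<longleftrightarrow>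
     X \<subseteq> pverts G \<and> Y \<subseteq> pverts G \<and> X \<inter> Y = {} \<and>
     \<not> dominating_set G X \<and> \<not> dominating_set G Y \<and> dominating_set G (X \<union> Y)"

definition c_partition :: "'a pair_pre_digraph \<Rightarrow> 'a set set \<Rightarrow> bool" where
  "c_partition G P \<longleftrightarrow>
     partition_on (pverts G) P \<and>
     (\<forall>X \<in> P. (dominating_set G X \<and> card X = 1) \<or> (\<exists>Y \<in> P. Y \<noteq> X \<and> coalition G X Y))"

definition proper_refinement :: "'a set \<Rightarrow> 'a set set \<Rightarrow> 'a set set \<Rightarrow> bool" where
  "proper_refinement A P Q \<longleftrightarrow> refines A P Q \<and> P \<noteq> Q"

definition minimal_c_partition :: "'a pair_pre_digraph \<Rightarrow> 'a set set \<Rightarrow> bool" where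
  "minimal_c_partition G P \<longleftrightarrow>
     c_partition G P \<and> (\<nexists>Q. c_partition G Q \<and> proper_refinement (pverts G) P Q)"

definition c_min :: "'a pair_pre_digraph \<Rightarrow> nat" where
  "c_min G = (LEAST k. \<exists>P. minimal_c_partition G P \<and> card P = k)"

definition edgeless_graph :: "nat \<Rightarrow> 'a pair_pre_digraph \<Rightarrow> bool" where
  "edgeless_graph n G \<longleftrightarrow> pair_graph G \<and> card (pverts G) = n \<and> parcs G = {}"

text \<open>The join of two graphs whose vertex sets are already disjoint.\<close>

definition join_graph ::
    "'a pair_pre_digraph \<Rightarrow> 'a pair_pre_digraph \<Rightarrow> 'a pair_pre_digraph" where
  "join_graph F H =
     \<lparr> pverts = pverts F \<union> pverts H,
       parcs = parcs F \<union> parcs H \<union> pverts F \<times> pverts H \<union> pverts H \<times> pverts F \<rparr>"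

text \<open>
  \<open>complete_digraph n\<close> and \<open>edgeless_graph n\<close> are predicates satisfied by every copy of the
  respective graph, so the rules range over all disjoint copies and the family is closed under
  isomorphism (lemma \<open>family_M_iso\<close> below), also across vertex types.
\<close>

inductive family_M :: "'a pair_pre_digraph \<Rightarrow> bool" where
  K1: "complete_digraph 1 (with_proj G) \<Longrightarrow> family_M G"
| K2: "complete_digraph 2 (with_proj G) \<Longrightarrow> family_M G"
| co_K2: "edgeless_graph 2 G \<Longrightarrow> family_M G"
| join_K1: "family_M H \<Longrightarrow> complete_digraph 1 (with_proj F) \<Longrightarrow> pverts F \<inter> pverts H = {} \<Longrightarrow>
    family_M (join_graph F H)"
| join_co_K2: "family_M H \<Longrightarrow> edgeless_graph 2 F \<Longrightarrow> pverts F \<inter> pverts H = {} \<Longrightarrow>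
    family_M (join_graph F H)"

definition map_graph :: "('a \<Rightarrow> 'b) \<Rightarrow> 'a pair_pre_digraph \<Rightarrow> 'b pair_pre_digraph" where
  "map_graph f G = \<lparr> pverts = f ` pverts G, parcs = map_prod f f ` parcs G \<rparr>"

lemma map_graph_complete:
  assumes "complete_digraph n (with_proj G)" "inj_on f (pverts G)"
  shows "complete_digraph n (with_proj (map_graph f G))"
proof -
  have *: "finite (pverts G)" "card (pverts G) = n"
    "parcs G = {(u,v). (u,v) \<in> pverts G \<times> pverts G \<and> u \<noteq> v}"
    using assms(1) by (auto simp: complete_digraph_pair_def)
  have "map_prod f f ` parcs G =
      {(u,v). (u,v) \<in> f ` pverts G \<times> f ` pverts G \<and> u \<noteq> v}"
    unfolding *(3) using assms(2) by (fastforce simp: inj_on_def)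
  then show ?thesis
    using *(1,2) assms(2) by (simp add: complete_digraph_pair_def map_graph_def card_image)
qed

lemma map_graph_edgeless:
  assumes "edgeless_graph n G" "inj_on f (pverts G)"
  shows "edgeless_graph n (map_graph f G)"
proof -
  interpret pair_graph G using assms(1) by (simp add: edgeless_graph_def)
  have "pair_graph (map_graph f G)"
    using assms(1) pair_finite_verts
    by unfold_locales (auto simp: map_graph_def edgeless_graph_def symmetric_def sym_def)
  then show ?thesis
    using assms by (simp add: edgeless_graph_def map_graph_def card_image)
qed

lemma map_graph_join:
  "map_graph f (join_graph F H) = join_graph (map_graph f F) (map_graph f H)"
proof -
  have times: "map_prod f f ` (A \<times> B) = f ` A \<times> f ` B" for A B
    by force
  show ?thesis
    by (simp add: map_graph_def join_graph_def image_Un times)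
qed

lemma family_M_map:
  assumes "family_M G" "inj_on f (pverts G)"
  shows "family_M (map_graph f G)"
  using assms
proof (induction rule: family_M.induct)
  case (join_K1 H F)
  then have "inj_on f (pverts F)" "inj_on f (pverts H)"
    and "pverts (map_graph f F) \<inter> pverts (map_graph f H) = {}"
    by (auto simp: join_graph_def map_graph_def inj_on_def)
  with join_K1 show ?case
    by (simp add: map_graph_join family_M.join_K1 map_graph_complete)
next
  case (join_co_K2 H F)
  then have "inj_on f (pverts F)" "inj_on f (pverts H)"
    and "pverts (map_graph f F) \<inter> pverts (map_graph f H) = {}"
    by (auto simp: join_graph_def map_graph_def inj_on_def)
  with join_co_K2 show ?case
    by (simp add: map_graph_join family_M.join_co_K2 map_graph_edgeless)
next
  case (K1 G)
  then show ?case by (intro family_M.K1 map_graph_complete)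
qed (auto intro: family_M.K2 family_M.co_K2 map_graph_complete map_graph_edgeless)

lemma family_M_iso:
  fixes G :: "'a pair_pre_digraph" and H :: "'b pair_pre_digraph"
  assumes "family_M G" "digraph_iso (with_proj G) (with_proj H)"
  shows "family_M H"
proof -
  obtain h where h: "pre_digraph.digraph_isomorphism (with_proj G) h"
    and H: "with_proj H = app_iso h (with_proj G)"
    using assms(2) by (auto simp: digraph_iso_def)
  have inj: "inj_on (iso_verts h) (pverts G)"
    and ends: "\<And>a. a \<in> parcs G \<Longrightarrow>
      iso_verts h (fst a) = iso_tail h (iso_arcs h a) \<and>
      iso_verts h (snd a) = iso_head h (iso_arcs h a)"
    using h by (auto simp: pre_digraph.digraph_isomorphism_def)
  have V: "pverts H = iso_verts h ` pverts G" and A: "parcs H = iso_arcs h ` parcs G"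
    and t: "fst = iso_tail h" and d: "snd = iso_head h"
    using H by (auto simp: with_proj_def app_iso_def)
  have "iso_arcs h a = map_prod (iso_verts h) (iso_verts h) a" if "a \<in> parcs G" for a
    using ends[OF that] by (simp add: prod_eq_iff flip: t d)
  then have "H = map_graph (iso_verts h) G"
    using V A by (simp add: map_graph_def)
  with family_M_map[OF assms(1) inj] show ?thesis by simp
qed

end

theory Submission
  imports Defs
begin

text \<open>
  Both sides of the equivalence say that any two distinct vertices of \<open>G\<close> form a dominating set,
  that is, that the complement of \<open>G\<close> has maximum degree at most one.

  For the family \<open>\<M>\<close> this is a matter of peeling off vertices: a vertex adjacent to all others
  is a factor \<open>K\<^sub>1\<close> of a join, and a vertex with its unique non-neighbour is a factor \<open>co-K\<^sub>2\<close>
  (lemmas \<open>family_M_imp_pairwise_dominating\<close> and \<open>pairwise_dominating_imp_family_M\<close>).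

  For \<open>c_min\<close>, suppose first that all pairs dominate. Then every part of a \<open>c\<close>-partition is a
  singleton, because a larger part would be a dominating set with several vertices, which is neither
  admissible on its own nor able to take part in a coalition. Hence no \<open>c\<close>-partition other than the one into singletons exists.
  Conversely, let some minimal \<open>c\<close>-partition have as many parts as there are vertices, so that it
  consists of the singletons. If a pair \<open>{x, y}\<close> did not dominate, merging \<open>{x}\<close> and \<open>{y}\<close> would
  again give a \<open>c\<close>-partition: the merged part inherits the coalition partner of \<open>{x}\<close>, and enlarging
  one side of a coalition to a non-dominating set disjoint from the other side keeps it a coalition
  (lemma \<open>c_partition_merge_singletons\<close>). This contradicts minimality.

  To make \<open>c_min\<close> the minimum of a nonempty set, one also has to know that every graph has a
  \<open>c\<close>-partition at all (lemma \<open>ex_c_partition\<close>), and thus a coarsest one.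
\<close>

section \<open>Dominating sets and coalitions\<close>

definition pairwise_dominating :: "'a pair_pre_digraph \<Rightarrow> bool" where
  "pairwise_dominating G \<longleftrightarrow>
     (\<forall>x \<in> pverts G. \<forall>y \<in> pverts G. x \<noteq> y \<longrightarrow> dominating_set G {x, y})"

lemma dominating_set_mono:
  assumes "dominating_set G S" "S \<subseteq> T" "T \<subseteq> pverts G"
  shows "dominating_set G T"
  using assms unfolding dominating_set_def by blast

lemma dominating_set_verts: "dominating_set G (pverts G)"
  by (simp add: dominating_set_def)

lemma coalition_sym: "coalition G X Y \<Longrightarrow> coalition G Y X"
  by (auto simp: coalition_def Un_commute Int_commute)

lemma coalition_enlarge:
  assumes "coalition G X Y" "Y \<subseteq> Z" "Z \<subseteq> pverts G" "X \<inter> Z = {}" "\<not> dominating_set G Z"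
  shows "coalition G X Z"
  using assms dominating_set_mono[of G "X \<union> Y" "X \<union> Z"] unfolding coalition_def by blast

section \<open>Existence of minimal \<open>c\<close>-partitions\<close>

text \<open>
  The parts come from minimal dominating subsets \<open>D\<close> of \<open>S\<close>. Such a \<open>D\<close> has at least two elements
  and splits into two non-dominating sets whose union dominates. What remains of \<open>S\<close> is treated
  recursively while it dominates; the last, non-dominating remainder \<open>W\<close> is a part of its own if it
  forms a coalition with one half of \<open>D\<close>, and otherwise it can be added to either half without
  making that half dominating.
\<close>
lemma ex_coalition_partition:
  assumes "finite S" "dominating_set G S" "pverts G \<noteq> {}"
    and "\<And>x. x \<in> S \<Longrightarrow> \<not> dominating_set G {x}"
  shows "\<exists>P. partition_on S P \<and> (\<forall>X \<in> P. \<exists>Y \<in> P. Y \<noteq> X \<and> coalition G X Y)"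
  using assms
proof (induction S rule: finite_psubset_induct)
  case (psubset S)
  let ?C = "{D. D \<subseteq> S \<and> dominating_set G D}"
  have fin: "finite ?C"
    using psubset.hyps by simp
  then obtain D where D: "D \<subseteq> S" "dominating_set G D"
    and D_min: "\<And>E. E \<subset> D \<Longrightarrow> \<not> dominating_set G E"
  proof -
    obtain D where "D \<in> ?C" "\<forall>E \<in> ?C. E \<subseteq> D \<longrightarrow> D = E"
      using finite_has_minimal[OF fin] psubset.prems(1) by blast
    then show ?thesis
      using that[of D] by blast
  qed
  have SV: "S \<subseteq> pverts G"
    using psubset.prems(1) by (simp add: dominating_set_def)
  have "D \<noteq> {}"
    using D(2) psubset.prems(2) by (auto simp: dominating_set_def)
  then obtain a where a: "a \<in> D" by blast
  define B where "B = D - {a}"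
  define W where "W = S - D"
  have "B \<noteq> {}"
    using D a psubset.prems(3)[of a] by (auto simp: B_def subset_singleton_iff)
  have na: "\<not> dominating_set G {a}"
    using D(1) a psubset.prems(3) by blast
  have nB: "\<not> dominating_set G B"
    by (rule D_min) (use a in \<open>auto simp: B_def\<close>)
  have D_eq: "insert a B = D" and aB: "a \<notin> B" and S_eq: "S = insert a (B \<union> W)"
    and aW: "a \<notin> W" and BW: "B \<inter> W = {}"
    using a D(1) by (auto simp: B_def W_def)
  have BV: "B \<subseteq> pverts G" and aV: "a \<in> pverts G" and WV: "W \<subseteq> pverts G"
    using SV S_eq by auto
  have ab: "coalition G {a} B"
    using na nB D(2) aB BV aV by (simp add: coalition_def D_eq)
  have ba: "coalition G B {a}"
    by (rule coalition_sym[OF ab])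
  have neq: "{a} \<noteq> B" using aB by blast
  have part: "partition_on S (insert {a} (insert B P))" if P: "partition_on W P" for P
  proof -
    have "\<Union>P = W" using P by (simp add: partition_on_def)
    moreover have "S - {a} - B = W" "disjnt {a} (B \<union> W)" "B \<subseteq> S - {a}"
      using S_eq aB aW BW by auto
    ultimately show ?thesis
      using P BW S_eq \<open>B \<noteq> {}\<close> by (simp add: partition_on_insert disjnt_def)
  qed
  consider "W = {}" | "dominating_set G W"
    | "W \<noteq> {}" "\<not> dominating_set G W" "dominating_set G (W \<union> {a}) \<or> dominating_set G (W \<union> B)"
    | "W \<noteq> {}" "\<not> dominating_set G (W \<union> B)"
    by blast
  then show ?case
  proof cases
    case 1
    have "disjnt {a} (\<Union>{B})" "S - {a} = B"
      using 1 S_eq aB by auto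
    then have "partition_on S {{a}, B}"
      using partition_on_insert[of "{a}" "{B}" S] partition_on_space[OF \<open>B \<noteq> {}\<close>] S_eq by simp
    moreover have "\<forall>X \<in> {{a}, B}. \<exists>Y \<in> {{a}, B}. Y \<noteq> X \<and> coalition G X Y"
      using ab ba neq by simp
    ultimately show ?thesis by blast
  next
    case 2
    have "W \<subset> S" using S_eq aW by blast
    moreover have "\<And>x. x \<in> W \<Longrightarrow> \<not> dominating_set G {x}"
      using psubset.prems(3) S_eq by blast
    ultimately obtain P where
      P: "partition_on W P" "\<forall>X \<in> P. \<exists>Y \<in> P. Y \<noteq> X \<and> coalition G X Y"
      using psubset.IH[of W] 2 psubset.prems(2) by blast
    have "partition_on S (insert {a} (insert B P))"
      using part[OF P(1)] .
    moreover have "\<forall>X \<in> insert {a} (insert B P). \<exists>Y \<in> insert {a} (insert B P).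
        Y \<noteq> X \<and> coalition G X Y"
      using ab ba neq P(2) by simp
    ultimately show ?thesis by blast
  next
    case 3
    have "partition_on S {{a}, B, W}"
      using part[OF partition_on_space[OF 3(1)]] .
    moreover have "W \<noteq> {a}" "W \<noteq> B" using aW BW 3(1) by auto
    moreover have "coalition G W {a} \<or> coalition G W B"
      using 3(2,3) na nB aV BV WV aW BW by (auto simp: coalition_def)
    ultimately show ?thesis
      using ab ba neq by (intro exI[of _ "{{a}, B, W}"]) (elim disjE; simp)
  next
    case 4
    have "disjnt {a} (\<Union>{B \<union> W})" "S - {a} = B \<union> W"
      using S_eq aB aW by auto
    then have "partition_on S {{a}, B \<union> W}"
      using partition_on_insert[of "{a}" "{B \<union> W}" S] partition_on_space[of "B \<union> W"]
        \<open>B \<noteq> {}\<close> S_eq by simp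
    moreover have c: "coalition G {a} (B \<union> W)"
      by (rule coalition_enlarge[OF ab]) (use 4 aB aW BV WV in \<open>simp_all add: Un_commute\<close>)
    moreover have "{a} \<noteq> B \<union> W" using aB aW by blast
    ultimately show ?thesis
      using coalition_sym[OF c] by (intro exI[of _ "{{a}, B \<union> W}"]) simp
  qed
qed

text \<open>
  Vertices that dominate alone are parts of their own. The remaining vertices, if there are any,
  form a dominating set, as each of the removed vertices is adjacent to all of them.
\<close>
lemma ex_c_partition:
  assumes "pair_graph G"
  shows "\<exists>P. c_partition G P"
proof -
  interpret pair_graph G by fact
  define R where "R = {v \<in> pverts G. \<not> dominating_set G {v}}"
  have "\<exists>P. partition_on R P \<and> (\<forall>X \<in> P. \<exists>Y \<in> P. Y \<noteq> X \<and> coalition G X Y)"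
  proof (cases "R = {}")
    case True
    then show ?thesis by (intro exI[of _ "{}"]) (simp add: partition_on_empty)
  next
    case False
    have "dominating_set G R"
      unfolding dominating_set_def
    proof (intro conjI ballI)
      show "R \<subseteq> pverts G" by (auto simp: R_def)
      fix v assume v: "v \<in> pverts G - R"
      obtain r where r: "r \<in> R" using False by blast
      have "dominating_set G {v}" "r \<in> pverts G - {v}"
        using v r by (auto simp: R_def)
      then have "(r, v) \<in> parcs G" by (auto simp: dominating_set_def)
      then show "\<exists>u \<in> R. (v, u) \<in> parcs G" using r arcs_symmetric by blast
    qed
    moreover have "finite R" "pverts G \<noteq> {}"
      using False by (auto simp: R_def)
    ultimately show ?thesis
      by (intro ex_coalition_partition) (auto simp: R_def)
  qed
  then obtain P where P: "partition_on R P" "\<forall>X \<in> P. \<exists>Y \<in> P. Y \<noteq> X \<and> coalition G X Y"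
    by blast
  let ?Q = "P \<union> (\<lambda>v. {v}) ` (pverts G - R)"
  have PR: "\<Union>P = R" using P(1) by (simp add: partition_on_def)
  have "partition_on (pverts G) ?Q"
  proof (rule partition_onI)
    show "\<Union>?Q = pverts G" unfolding Union_Un_distrib PR by (auto simp: R_def)
    show "{} \<notin> ?Q" using P(1) by (auto simp: partition_on_def)
    show "disjnt p q" if "p \<in> ?Q" "q \<in> ?Q" "p \<noteq> q" for p q
    proof -
      have *: "x \<in> R" if "X \<in> P" "x \<in> X" for X x using that PR by blast
      have "disjnt p q" if "p \<in> P" "q \<in> P"
        using partition_onD2[OF P(1)] that \<open>p \<noteq> q\<close> by (rule pairwiseD)
      then show ?thesis
        using \<open>p \<in> ?Q\<close> \<open>q \<in> ?Q\<close> \<open>p \<noteq> q\<close> by (elim UnE imageE) (auto simp: disjnt_iff dest: *)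
    qed
  qed
  then have "c_partition G ?Q"
    using P(2) unfolding c_partition_def by (fastforce simp: R_def)
  then show ?thesis by blast
qed

text \<open>A coarsest one among the finitely many \<open>c\<close>-partitions is minimal.\<close>
lemma ex_minimal_c_partition:
  assumes "pair_graph G"
  shows "\<exists>P. minimal_c_partition G P"
proof -
  interpret pair_graph G by fact
  let ?C = "{P. c_partition G P}" and ?R = "proper_refinement (pverts G)"
  have "finite ?C"
    by (rule finite_subset[OF _ finitely_many_partition_on[OF pair_finite_verts]])
      (auto simp: c_partition_def)
  moreover have "?C \<noteq> {}"
    using ex_c_partition[OF assms] by blast
  moreover have "asymp_on ?C ?R"
    unfolding asymp_on_def proper_refinement_def by (meson refines_asym)
  moreover have "transp_on ?C ?R"
    unfolding transp_on_def proper_refinement_def by (metis refines_asym refines_trans)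
  ultimately obtain P where "P \<in> ?C" "\<forall>Q \<in> ?C. Q \<noteq> P \<longrightarrow> \<not> ?R P Q"
    using Finite_Set.bex_max_element[of ?C ?R] by blast
  then show ?thesis
    by (auto simp: minimal_c_partition_def proper_refinement_def)
qed

lemma c_min_attained:
  assumes "pair_graph G"
  obtains P where "minimal_c_partition G P" "card P = c_min G"
proof -
  have "\<exists>k P. minimal_c_partition G P \<and> card P = k"
    using ex_minimal_c_partition[OF assms] by blast
  from LeastI_ex[OF this] show ?thesis
    using that unfolding c_min_def by blast
qed

section \<open>The partition into singletons\<close>

lemma partition_on_eq_singletons:
  assumes "partition_on A P" "\<And>X. X \<in> P \<Longrightarrow> card X = 1"
  shows "P = (\<lambda>x. {x}) ` A"
proof -
  have A: "A = \<Union>P" using assms(1) by (rule partition_onD1)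
  have single: "\<exists>x. X = {x}" if "X \<in> P" for X
    using assms(2)[OF that] by (auto simp: card_1_singleton_iff)
  show ?thesis
    unfolding A using single by (force simp: image_iff)
qed

text \<open>The sizes of the parts are positive integers with average one.\<close>
lemma partition_on_card_eq_imp_singletons:
  assumes "finite A" "partition_on A P" "card P = card A"
  shows "P = (\<lambda>x. {x}) ` A"
proof (rule partition_on_eq_singletons[OF assms(2)])
  fix X assume X: "X \<in> P"
  have fin: "finite P" using assms(1,2) by (rule finite_elements)
  have finp: "finite p" if "p \<in> P" for p
    using that assms(1,2) by (auto simp: partition_on_def intro: finite_subset)
  have pos: "card p \<ge> 1" if "p \<in> P" for p
    using that finp[OF that] assms(2) by (auto simp: partition_on_def Suc_le_eq card_gt_0_iff)
  have "(\<Sum>p\<in>P. card p) = (\<Sum>p\<in>P. 1)"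
    using product_partition[OF assms(2) finp] assms(3) by simp
  then have "\<forall>p\<in>P. card p = 1"
    using sum_mono_inv[of "\<lambda>_. 1" P card] pos X fin by (metis (no_types, lifting))
  with X show "card X = 1" by blast
qed

text \<open>
  The merged part \<open>{x, y}\<close> inherits the coalition partner of \<open>{x}\<close>. That partner is not \<open>{y}\<close>, as
  \<open>{x, y}\<close> does not dominate. Coalitions that involved \<open>{x}\<close> or \<open>{y}\<close> survive as well.
\<close>
lemma c_partition_merge_singletons:
  assumes "c_partition G ((\<lambda>v. {v}) ` pverts G)"
    and xy: "x \<in> pverts G" "y \<in> pverts G"
    and nd: "\<not> dominating_set G {x, y}"
  shows "c_partition G (insert {x, y} ((\<lambda>v. {v}) ` (pverts G - {x, y})))"
    (is "c_partition G ?Q")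
proof -
  have partner: "\<exists>w. w \<in> pverts G \<and> w \<noteq> v \<and> coalition G {v} {w}"
    if "v \<in> pverts G" "\<not> dominating_set G {v}" for v
    using assms(1) that by (auto simp: c_partition_def)
  have nx: "\<not> dominating_set G {x}"
    using nd xy dominating_set_mono[of G "{x}" "{x, y}"] by auto
  have to_merged: "coalition G {v} {x, y}"
    if "v \<notin> {x, y}" "coalition G {v} {w}" "w \<in> {x, y}" for v w
    by (rule coalition_enlarge[OF that(2)]) (use that xy nd in auto)
  have "partition_on (pverts G) ?Q"
    using xy by (auto simp: partition_on_def disjoint_def)
  moreover have "(dominating_set G X \<and> card X = 1) \<or> (\<exists>Y \<in> ?Q. Y \<noteq> X \<and> coalition G X Y)"
    if X: "X \<in> ?Q" for X
  proof -
    consider "X = {x, y}" | v where "X = {v}" "v \<in> pverts G" "v \<notin> {x, y}" "dominating_set G {v}"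
      | v where "X = {v}" "v \<in> pverts G" "v \<notin> {x, y}" "\<not> dominating_set G {v}"
      using X by blast
    then show ?thesis
    proof cases
      case 1
      obtain w where w: "w \<in> pverts G" "w \<noteq> x" "coalition G {x} {w}"
        using partner[OF xy(1) nx] by blast
      then have "w \<noteq> y"
        using nd by (auto simp: coalition_def insert_commute)
      with w have "coalition G {w} {x, y}"
        by (intro to_merged[of w x]) (auto intro: coalition_sym)
      then have "coalition G X {w}" using 1 coalition_sym by blast
      moreover have "{w} \<in> ?Q" "{w} \<noteq> X" using w \<open>w \<noteq> y\<close> 1 by auto
      ultimately show ?thesis by (intro disjI2 bexI[of _ "{w}"] conjI)
    next
      case 2
      then show ?thesis by simp
    next
      case (3 v)
      obtain w where w: "w \<in> pverts G" "w \<noteq> v" "coalition G {v} {w}"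
        using partner[OF 3(2,4)] by blast
      show ?thesis
      proof (cases "w \<in> {x, y}")
        case True
        have "coalition G X {x, y}"
          using to_merged[OF 3(3) w(3) True] 3(1) by simp
        moreover have "{x, y} \<noteq> X" using 3(1,3) by auto
        ultimately show ?thesis by (intro disjI2 bexI[of _ "{x, y}"] conjI) auto
      next
        case False
        then have "{w} \<in> ?Q" "{w} \<noteq> X" using w 3(1) by auto
        then show ?thesis using w(3) 3(1) by (intro disjI2 bexI[of _ "{w}"] conjI) auto
      qed
    qed
  qed
  ultimately show ?thesis
    unfolding c_partition_def by (intro conjI ballI)
qed

lemma minimal_singletons_imp_pairwise_dominating:
  assumes "minimal_c_partition G ((\<lambda>v. {v}) ` pverts G)" (is "minimal_c_partition G ?S")
  shows "pairwise_dominating G"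
  unfolding pairwise_dominating_def
proof (intro ballI impI, rule ccontr)
  fix x y
  assume xy: "x \<in> pverts G" "y \<in> pverts G" "x \<noteq> y" and nd: "\<not> dominating_set G {x, y}"
  let ?Q = "insert {x, y} ((\<lambda>v. {v}) ` (pverts G - {x, y}))"
  have S: "c_partition G ?S"
    using assms by (simp add: minimal_c_partition_def)
  have Q: "c_partition G ?Q"
    by (rule c_partition_merge_singletons[OF S xy(1,2) nd])
  have "{x, y} \<notin> ?S" using xy(3) by auto
  then have "?S \<noteq> ?Q" by blast
  moreover have "refines (pverts G) ?S ?Q"
    using S Q by (auto simp: refines_def c_partition_def)
  ultimately show False
    using assms Q by (auto simp: minimal_c_partition_def proper_refinement_def)
qed

lemma pairwise_dominating_c_partition_imp_singletons:
  assumes "pairwise_dominating G" "c_partition G P"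
  shows "P = (\<lambda>v. {v}) ` pverts G"
proof (rule partition_on_eq_singletons)
  show part: "partition_on (pverts G) P"
    using assms(2) by (simp add: c_partition_def)
  fix X assume X: "X \<in> P"
  then have XV: "X \<subseteq> pverts G" and "X \<noteq> {}"
    using part by (auto simp: partition_on_def)
  show "card X = 1"
  proof (rule ccontr)
    assume n1: "card X \<noteq> 1"
    obtain x where "x \<in> X" using \<open>X \<noteq> {}\<close> by blast
    moreover obtain y where "y \<in> X" "y \<noteq> x"
      using n1 \<open>x \<in> X\<close> card_1_singleton_iff[of X] by auto
    ultimately have "dominating_set G {x, y}" "{x, y} \<subseteq> X"
      using assms(1) XV by (auto simp: pairwise_dominating_def subset_iff)
    then have "dominating_set G X"
      using XV by (rule dominating_set_mono)
    with n1 X assms(2) show False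
      by (auto simp: c_partition_def coalition_def)
  qed
qed

lemma c_min_eq_card_iff_pairwise_dominating:
  assumes "pair_graph G"
  shows "c_min G = card (pverts G) \<longleftrightarrow> pairwise_dominating G"
proof -
  interpret pair_graph G by fact
  obtain P where P: "minimal_c_partition G P" "card P = c_min G"
    using c_min_attained[OF assms] .
  have cP: "c_partition G P"
    using P(1) by (simp add: minimal_c_partition_def)
  show ?thesis
  proof
    assume "c_min G = card (pverts G)"
    with P cP have "P = (\<lambda>v. {v}) ` pverts G"
      by (intro partition_on_card_eq_imp_singletons) (auto simp: c_partition_def)
    with P(1) show "pairwise_dominating G"
      using minimal_singletons_imp_pairwise_dominating by blast
  next
    assume "pairwise_dominating G"
    from pairwise_dominating_c_partition_imp_singletons[OF this cP]
    show "c_min G = card (pverts G)"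
      using P(2) by (simp add: card_image)
  qed
qed

section \<open>The family \<open>\<M>\<close>\<close>

lemma pairwise_dominating_join:
  assumes "pairwise_dominating F" "pairwise_dominating H"
  shows "pairwise_dominating (join_graph F H)"
  unfolding pairwise_dominating_def
proof (intro ballI impI)
  fix x y
  assume xy: "x \<in> pverts (join_graph F H)" "y \<in> pverts (join_graph F H)" "x \<noteq> y"
  have "\<exists>u \<in> {x, y}. (v, u) \<in> parcs (join_graph F H)"
    if v: "v \<in> pverts (join_graph F H) - {x, y}" for v
  proof -
    consider "{v, x, y} \<subseteq> pverts F" | "{v, x, y} \<subseteq> pverts H"
      | u where "u \<in> {x, y}" "(v, u) \<in> pverts F \<times> pverts H \<union> pverts H \<times> pverts F"
      using xy v unfolding join_graph_def by simp blast
    then show ?thesis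
    proof cases
      case 1
      with assms(1) xy(3) have "dominating_set F {x, y}"
        by (simp add: pairwise_dominating_def)
      with 1 v show ?thesis by (auto simp: dominating_set_def join_graph_def)
    next
      case 2
      with assms(2) xy(3) have "dominating_set H {x, y}"
        by (simp add: pairwise_dominating_def)
      with 2 v show ?thesis by (auto simp: dominating_set_def join_graph_def)
    next
      case (3 u)
      then show ?thesis by (auto simp: join_graph_def)
    qed
  qed
  then show "dominating_set (join_graph F H) {x, y}"
    using xy by (simp add: dominating_set_def)
qed

lemma pairwise_dominating_card_le_2:
  assumes "finite (pverts G)" "card (pverts G) \<le> 2"
  shows "pairwise_dominating G"
  unfolding pairwise_dominating_def
proof (intro ballI impI)
  fix x y assume xy: "x \<in> pverts G" "y \<in> pverts G" "x \<noteq> y"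
  then have "{x, y} = pverts G"
    using assms by (intro card_seteq) auto
  then show "dominating_set G {x, y}" by (simp add: dominating_set_verts)
qed

lemma family_M_imp_pairwise_dominating:
  assumes "family_M G"
  shows "pairwise_dominating G"
proof -
  have small: "pairwise_dominating F"
    if "complete_digraph 1 (with_proj F) \<or> complete_digraph 2 (with_proj F) \<or> edgeless_graph 2 F"
    for F :: "'a pair_pre_digraph"
  proof (rule pairwise_dominating_card_le_2)
    show "finite (pverts F)" "card (pverts F) \<le> 2"
      using that by (auto simp: complete_digraph_pair_def edgeless_graph_def intro: card_ge_0_finite)
  qed
  show ?thesis
    using assms by induction (blast intro: small pairwise_dominating_join)+
qed

definition induced_graph :: "'a pair_pre_digraph \<Rightarrow> 'a set \<Rightarrow> 'a pair_pre_digraph" where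
  "induced_graph G U = \<lparr> pverts = U, parcs = parcs G \<inter> U \<times> U \<rparr>"

lemma pair_graph_induced:
  assumes "pair_graph G" "U \<subseteq> pverts G"
  shows "pair_graph (induced_graph G U)"
proof -
  interpret pair_graph G by fact
  show ?thesis
    using assms(2) pair_finite_verts arcs_symmetric no_loops'
    by unfold_locales
      (auto simp: induced_graph_def symmetric_def sym_def finite_subset)
qed

lemma pairwise_dominating_induced:
  assumes "pairwise_dominating G" "U \<subseteq> pverts G"
  shows "pairwise_dominating (induced_graph G U)"
  using assms unfolding pairwise_dominating_def dominating_set_def induced_graph_def
  by (auto simp: subset_iff)

lemma eq_join_induced:
  assumes "pair_graph G" "U \<subseteq> pverts G"
    and "\<And>u v. u \<in> U \<Longrightarrow> v \<in> pverts G - U \<Longrightarrow> (u, v) \<in> parcs G"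
  shows "G = join_graph (induced_graph G U) (induced_graph G (pverts G - U))"
proof -
  interpret pair_graph G by fact
  have "parcs G = parcs G \<inter> U \<times> U \<union> parcs G \<inter> (pverts G - U) \<times> (pverts G - U)
      \<union> U \<times> (pverts G - U) \<union> (pverts G - U) \<times> U"
    (is "_ = ?A")
  proof
    show "parcs G \<subseteq> ?A"
      using wellformed' by auto
    show "?A \<subseteq> parcs G"
      using assms(3) arcs_symmetric by blast
  qed
  moreover have "pverts G = U \<union> (pverts G - U)"
    using assms(2) by blast
  ultimately show ?thesis
    by (cases G) (simp add: join_graph_def induced_graph_def)
qed

text \<open>
  If some vertex \<open>v\<close> has a non-neighbour \<open>w\<close>, then both are adjacent to every further vertex \<open>u\<close>:
  as \<open>{u, w}\<close> dominates \<open>v\<close>, there is an edge between \<open>u\<close> and \<open>v\<close>, and likewise for \<open>w\<close>.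
  So \<open>{v, w}\<close> is a factor \<open>co-K\<^sub>2\<close> of a join. If all pairs are adjacent, any vertex is a
  factor \<open>K\<^sub>1\<close>.
\<close>
lemma pairwise_dominating_imp_family_M:
  assumes "pair_graph G" "pverts G \<noteq> {}" "pairwise_dominating G"
  shows "family_M G"
  using assms
proof (induction "card (pverts G)" arbitrary: G rule: less_induct)
  case less
  interpret pair_graph G by fact
  have split: "family_M (induced_graph G (pverts G - U))"
      "G = join_graph (induced_graph G U) (induced_graph G (pverts G - U))"
    if U: "U \<subseteq> pverts G" "U \<noteq> {}" "U \<noteq> pverts G"
      "\<And>u v. u \<in> U \<Longrightarrow> v \<in> pverts G - U \<Longrightarrow> (u, v) \<in> parcs G" for U
  proof -
    have "card (pverts G - U) < card (pverts G)"
      using U(1,2) by (intro psubset_card_mono) auto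
    then show "family_M (induced_graph G (pverts G - U))"
      using U less.prems
      by (intro less.hyps pair_graph_induced pairwise_dominating_induced)
        (auto simp: induced_graph_def)
    show "G = join_graph (induced_graph G U) (induced_graph G (pverts G - U))"
      using U(1,4) by (rule eq_join_induced[OF less.prems(1)])
  qed
  have disj: "pverts (induced_graph G U) \<inter> pverts (induced_graph G (pverts G - U)) = {}" for U
    by (auto simp: induced_graph_def)
  have induced_all: "induced_graph G (pverts G) = G"
    using wellformed' by (cases G) (auto simp: induced_graph_def)
  show ?case
  proof (cases "\<exists>v \<in> pverts G. \<exists>w \<in> pverts G. v \<noteq> w \<and> (v, w) \<notin> parcs G")
    case True
    then obtain v w where vw: "v \<in> pverts G" "w \<in> pverts G" "v \<noteq> w" "(v, w) \<notin> parcs G"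
      by blast
    then have wv: "(w, v) \<notin> parcs G" using arcs_symmetric by blast
    have adj: "(p, u) \<in> parcs G" if "p \<in> {v, w}" "u \<in> pverts G - {v, w}" for p u
    proof -
      obtain q where q: "q \<in> {v, w}" "p \<noteq> q" "(p, q) \<notin> parcs G" "p \<in> pverts G" "q \<in> pverts G"
        using \<open>p \<in> {v, w}\<close> vw wv by auto
      then have "dominating_set G {u, q}" "p \<notin> {u, q}"
        using that less.prems(3) by (auto simp: pairwise_dominating_def)
      then show ?thesis
        using q by (auto simp: dominating_set_def)
    qed
    have "parcs (induced_graph G {v, w}) = {}"
      using vw wv no_loops' by (auto simp: induced_graph_def)
    then have co: "edgeless_graph 2 (induced_graph G {v, w})"
      using vw pair_graph_induced[OF less.prems(1), of "{v, w}"]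
      by (simp add: edgeless_graph_def induced_graph_def)
    show ?thesis
    proof (cases "pverts G = {v, w}")
      case True
      then show ?thesis using co induced_all family_M.co_K2 by metis
    next
      case False
      then have "family_M (induced_graph G (pverts G - {v, w}))"
        "G = join_graph (induced_graph G {v, w}) (induced_graph G (pverts G - {v, w}))"
        using vw adj by (auto intro!: split)
      then show ?thesis
        using family_M.join_co_K2[OF _ co disj] by metis
    qed
  next
    case False
    obtain v where v: "v \<in> pverts G" using less.prems(2) by blast
    have K1: "complete_digraph 1 (with_proj (induced_graph G {v}))"
      using no_loops' by (auto simp: complete_digraph_pair_def induced_graph_def)
    show ?thesis
    proof (cases "pverts G = {v}")
      case True
      then show ?thesis using K1 induced_all family_M.K1 by metis
    next
      case neq: False
      have "family_M (induced_graph G (pverts G - {v}))"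
        "G = join_graph (induced_graph G {v}) (induced_graph G (pverts G - {v}))"
        using v neq False by (auto intro!: split)
      then show ?thesis
        using family_M.join_K1[OF _ K1 disj] by metis
    qed
  qed
qed

theorem theorem2:
  fixes G :: "'a pair_pre_digraph" and n :: nat
  assumes "pair_graph G"
    and "connected (with_proj G)"
    and "card (pverts G) = n" and "n \<ge> 3"
  shows "c_min G = n \<longleftrightarrow> family_M G"
proof -
  have "pverts G \<noteq> {}" using assms(3,4) by auto
  then have "pairwise_dominating G \<longleftrightarrow> family_M G"
    using pairwise_dominating_imp_family_M[OF assms(1)] family_M_imp_pairwise_dominating by blast
  with c_min_eq_card_iff_pairwise_dominating[OF assms(1)] show ?thesis
    using assms(3) by simp
qed

end
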